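(* For every $n\ge1$, the inner product function $(x,y)\mapsto x\cdot y=\sum_jx_jy_j\bmod2$ on $\{0,1\}^n\times\{0,1\}^n$ can be computed exactly (with zero error on every input) in the simultaneous message passing model with entanglement, with $\lceil n/2\rceil+2$ qubits of communication from each party.
   Context: Simultaneous message passing (SMP) model with entanglement: Alice holds $x$, Bob holds $y$, and they share an arbitrary entangled state independent of the inputs. Without communicating with each other, each applies a quantum operation (depending on the own input) to the own qubits and sends a quantum message to a referee, who holds no input and no share of the entanglement. The referee measures the two messages jointly and outputs the value of the function. *)

theory Defs
  imports "Jordan_Normal_Form.Schur_Decomposition" "HOL-Library.Z2"
begin

definition mat_trace :: "complex mat \<Rightarrow> complex" where
  "mat_trace A = (\<Sum>i<dim_row A. A $$ (i, i))"

(* Kronecker product; the basis vector e_i (x) e_j has index i * d + j,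
   where d is the dimension of the second factor. *)
definition kron :: "complex mat \<Rightarrow> complex mat \<Rightarrow> complex mat" where
  "kron A B = mat (dim_row A * dim_row B) (dim_col A * dim_col B)
     (\<lambda>(i, j). A $$ (i div dim_row B, j div dim_col B) * B $$ (i mod dim_row B, j mod dim_col B))"

(* The order on complex numbers is such that 0 \<le> z means "z is real and nonnegative";
   over the complex numbers this condition also makes A Hermitian. *)
definition positive_semidefinite :: "nat \<Rightarrow> complex mat \<Rightarrow> bool" where
  "positive_semidefinite d A \<longleftrightarrow>
     A \<in> carrier_mat d d \<and> (\<forall>v\<in>carrier_vec d. 0 \<le> (A *\<^sub>v v) \<bullet>c v)"

definition density_operator :: "nat \<Rightarrow> complex mat \<Rightarrow> bool" where
  "density_operator d \<rho> \<longleftrightarrow> positive_semidefinite d \<rho> \<and> mat_trace \<rho> = 1"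

definition msum :: "nat \<Rightarrow> nat \<Rightarrow> complex mat list \<Rightarrow> complex mat" where
  "msum r c Ms = foldr (+) Ms (0\<^sub>m r c)"

(* A quantum operation (completely positive trace-preserving map) from dimension d to
   dimension e, given in operator-sum form by a finite list of Kraus operators. *)
definition quantum_operation :: "nat \<Rightarrow> nat \<Rightarrow> complex mat list \<Rightarrow> bool" where
  "quantum_operation d e Ks \<longleftrightarrow>
     set Ks \<subseteq> carrier_mat e d \<and> msum d d (map (\<lambda>K. mat_adjoint K * K) Ks) = 1\<^sub>m d"

(* The action of the tensor product of two quantum operations, with Kraus operators Ks and Ls
   and output dimensions e and e', on a bipartite state: its Kraus operators are K (x) L. *)
definition apply_local :: "nat \<Rightarrow> nat \<Rightarrow> complex mat list \<Rightarrow> complex mat list \<Rightarrow> complex mat \<Rightarrow> complex mat"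
  where "apply_local e e' Ks Ls \<rho> = msum (e * e') (e * e')
     (map (\<lambda>(K, L). kron K L * \<rho> * mat_adjoint (kron K L)) (List.product Ks Ls))"

definition binary_povm :: "nat \<Rightarrow> (bit \<Rightarrow> complex mat) \<Rightarrow> bool" where
  "binary_povm d E \<longleftrightarrow> (\<forall>b. positive_semidefinite d (E b)) \<and> E 0 + E 1 = 1\<^sub>m d"

(* rho is the shared state, Alice holding the first tensor factor (dimension dA) and Bob the
   second (dimension dB); A x and B y are the parties' operations, producing messages of
   qA and qB qubits; the outcome of E on the two messages is the referee's output. *)
definition smp_protocol ::
  "nat \<Rightarrow> nat \<Rightarrow> nat \<Rightarrow> nat \<Rightarrow> 'x set \<Rightarrow> 'y set \<Rightarrow> complex mat \<Rightarrow>
   ('x \<Rightarrow> complex mat list) \<Rightarrow> ('y \<Rightarrow> complex mat list) \<Rightarrow> (bit \<Rightarrow> complex mat) \<Rightarrow> bool"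
  where "smp_protocol dA dB qA qB X Y \<rho> A B E \<longleftrightarrow>
     density_operator (dA * dB) \<rho> \<and>
     (\<forall>x\<in>X. quantum_operation dA (2 ^ qA) (A x)) \<and>
     (\<forall>y\<in>Y. quantum_operation dB (2 ^ qB) (B y)) \<and>
     binary_povm (2 ^ qA * 2 ^ qB) E"

definition smp_output_prob ::
  "nat \<Rightarrow> nat \<Rightarrow> complex mat \<Rightarrow> ('x \<Rightarrow> complex mat list) \<Rightarrow> ('y \<Rightarrow> complex mat list) \<Rightarrow>
   (bit \<Rightarrow> complex mat) \<Rightarrow> 'x \<Rightarrow> 'y \<Rightarrow> bit \<Rightarrow> complex"
  where "smp_output_prob qA qB \<rho> A B E x y b =
     mat_trace (E b * apply_local (2 ^ qA) (2 ^ qB) (A x) (B y) \<rho>)"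

definition smp_entangled_exact ::
  "nat \<Rightarrow> nat \<Rightarrow> 'x set \<Rightarrow> 'y set \<Rightarrow> ('x \<Rightarrow> 'y \<Rightarrow> bit) \<Rightarrow> bool"
  where "smp_entangled_exact qA qB X Y f \<longleftrightarrow>
     (\<exists>dA dB \<rho> A B E. smp_protocol dA dB qA qB X Y \<rho> A B E \<and>
        (\<forall>x\<in>X. \<forall>y\<in>Y. smp_output_prob qA qB \<rho> A B E x y (f x y) = 1))"

(* On vectors over the two-element field, the scalar product is the sum of the x_j y_j modulo 2. *)
definition inner_product_fun :: "bit vec \<Rightarrow> bit vec \<Rightarrow> bit" where
  "inner_product_fun x y = x \<bullet> y"

end

theory Submission
  imports Defs
begin

text \<open>Let \<open>m = \<lceil>n/2\<rceil>\<close>. The parties share \<open>m\<close> EPR pairs. Each of them encodes up to \<open>2m\<close> input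
  bits in an \<open>m\<close>-qubit Pauli operator applied to the own halves, sends these halves, and adds two
  classical bits holding the Hamming weight of the input modulo 4. Up to a sign, the referee then
  holds the Bell state labelled by \<open>x \<oplus> y\<close>, so that a Bell measurement reveals \<open>x \<oplus> y\<close> with
  certainty, and \<open>|x| + |y| = |x \<oplus> y| + 2 |x \<and> y|\<close> modulo 4 determines the parity of \<open>|x \<and> y|\<close>.\<close>

section \<open>Adjoints, traces and sums over product indices\<close>

lemma mat_adjoint_carrier [simp]:
  "A \<in> carrier_mat r c \<Longrightarrow> mat_adjoint A \<in> carrier_mat c r"
  unfolding mat_adjoint_def by (auto simp: mat_of_rows_def)

lemma dim_mat_adjoint [simp]:
  "dim_row (mat_adjoint A) = dim_col A" "dim_col (mat_adjoint A) = dim_row A"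
  unfolding mat_adjoint_def by (auto simp: mat_of_rows_def)

lemma index_mat_adjoint [simp]:
  assumes "i < dim_col A" "j < dim_row A"
  shows "mat_adjoint A $$ (i, j) = conjugate (A $$ (j, i))"
  using assms unfolding mat_adjoint_def by (simp add: mat_of_rows_def)

lemma mat_adjoint_mult:
  fixes A B :: "complex mat"
  assumes A: "A \<in> carrier_mat r k" and B: "B \<in> carrier_mat k c"
  shows "mat_adjoint (A * B) = mat_adjoint B * mat_adjoint A"
proof (rule eq_matI)
  fix i j assume "i < dim_row (mat_adjoint B * mat_adjoint A)"
    and "j < dim_col (mat_adjoint B * mat_adjoint A)"
  then have ij: "i < c" "j < r" using A B by auto
  show "mat_adjoint (A * B) $$ (i, j) = (mat_adjoint B * mat_adjoint A) $$ (i, j)"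
    using A B ij by (simp add: scalar_prod_def mult.commute)
qed (use A B in auto)

lemma mat_trace_comm:
  assumes A: "A \<in> carrier_mat r c" and B: "B \<in> carrier_mat c r"
  shows "mat_trace (A * B) = mat_trace (B * A)"
proof -
  have "mat_trace (A * B) = (\<Sum>i<r. \<Sum>j<c. A $$ (i, j) * B $$ (j, i))"
    using A B by (simp add: mat_trace_def scalar_prod_def atLeast0LessThan)
  also have "\<dots> = (\<Sum>j<c. \<Sum>i<r. B $$ (j, i) * A $$ (i, j))"
    by (subst sum.swap) (simp add: mult.commute)
  also have "\<dots> = mat_trace (B * A)"
    using A B by (simp add: mat_trace_def scalar_prod_def atLeast0LessThan)
  finally show ?thesis .
qed

text \<open>The quadratic form at \<open>v\<close> is the squared norm of the image of
  \<open>v\<close> under \<open>mat_adjoint A\<close>. This serves both the shared pure state and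
  the referee's measurement operators.\<close>

lemma positive_semidefinite_mult_adjoint:
  assumes A: "A \<in> carrier_mat d r"
  shows "positive_semidefinite d (A * mat_adjoint A)"
  unfolding positive_semidefinite_def
proof (intro conjI ballI)
  fix v :: "complex vec" assume v: "v \<in> carrier_vec d"
  define w where "w = mat_adjoint A *\<^sub>v v"
  have w: "w \<in> carrier_vec r" using A v by (simp add: w_def mult_mat_vec_carrier[of _ r d])
  have "(A * mat_adjoint A *\<^sub>v v) \<bullet>c v = (A *\<^sub>v w) \<bullet>c v"
    using A v by (simp add: w_def assoc_mult_mat_vec[of _ d r _ d])
  also have "\<dots> = (\<Sum>i<d. \<Sum>j<r. A $$ (i, j) * w $ j * cnj (v $ i))"
    using A v w by (simp add: scalar_prod_def atLeast0LessThan sum_distrib_right)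
  also have "\<dots> = (\<Sum>j<r. w $ j * (\<Sum>i<d. A $$ (i, j) * cnj (v $ i)))"
    by (subst sum.swap) (simp add: sum_distrib_left mult_ac)
  also have "\<dots> = (\<Sum>j<r. w $ j * cnj (w $ j))"
    using A v by (intro sum.cong) (auto simp: w_def scalar_prod_def atLeast0LessThan)
  finally show "0 \<le> (A * mat_adjoint A *\<^sub>v v) \<bullet>c v"
    using conjugate_square_positive[where 'a = complex] by (simp add: sum_nonneg)
qed (use A in auto)

lemma div_less_factor: "p < a * b \<Longrightarrow> p div b < (a::nat)"
  by (simp add: less_mult_imp_div_less)

lemma mod_less_factor: "p < a * b \<Longrightarrow> p mod b < (b::nat)"
  by (metis mod_less_divisor mult_0_right not_gr_zero not_less_zero)

text \<open>The inverse is the index convention \<open>i * b + j\<close> of \<open>kron\<close>;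
  sums over a product index thus become double sums.\<close>

lemma bij_betw_div_mod:
  fixes a b :: nat
  shows "bij_betw (\<lambda>i. (i div b, i mod b)) {..<a * b} ({..<a} \<times> {..<b})"
proof (rule bij_betw_byWitness[where f' = "\<lambda>(i, j). i * b + j"])
  show "(\<lambda>i. (i div b, i mod b)) ` {..<a * b} \<subseteq> {..<a} \<times> {..<b}"
    by (auto simp: div_less_factor mod_less_factor)
  show "(\<lambda>(i, j). i * b + j) ` ({..<a} \<times> {..<b}) \<subseteq> {..<a * b}"
  proof clarsimp
    fix i j assume "i < a" "j < b"
    then have "i * b + j < Suc i * b" by simp
    also have "Suc i * b \<le> a * b" using \<open>i < a\<close> by (intro mult_le_mono1) simp
    finally show "i * b + j < a * b" .
  qed
qed auto

lemma sum_div_mod: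
  fixes f :: "nat \<Rightarrow> nat \<Rightarrow> 'a::comm_monoid_add"
  shows "(\<Sum>i<a * b. f (i div b) (i mod b)) = (\<Sum>i<a. \<Sum>j<b. f i j)"
  using sum.reindex_bij_betw[OF bij_betw_div_mod[of b a], of "\<lambda>(i, j). f i j"]
  by (simp add: sum.cartesian_product)

lemma kron_carrier:
  assumes "A \<in> carrier_mat r c" "B \<in> carrier_mat r' c'"
  shows "kron A B \<in> carrier_mat (r * r') (c * c')"
  using assms by (auto simp: kron_def)

section \<open>Protocols with local isometries and a projective measurement\<close>

text \<open>Reduces a protocol to amplitudes: each party applies an isometry (a single Kraus
  operator) to its part of a pure state, and the referee measures in the orthonormal basis of
  columns of \<open>U\<close> and maps the outcome by \<open>g\<close>. If the joint message is one
  such column up to a phase, that outcome is certain; the phase may depend on both inputs.\<close>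

lemma smp_entangled_exact_isometries:
  fixes V :: "'x \<Rightarrow> complex mat" and W :: "'y \<Rightarrow> complex mat" and \<Phi> U :: "complex mat"
    and g :: "nat \<Rightarrow> bit" and qA qB :: nat
  defines "N \<equiv> 2 ^ qA * 2 ^ qB"
  assumes V: "\<And>x. x \<in> X \<Longrightarrow> V x \<in> carrier_mat (2 ^ qA) dA"
      "\<And>x. x \<in> X \<Longrightarrow> mat_adjoint (V x) * V x = 1\<^sub>m dA"
    and W: "\<And>y. y \<in> Y \<Longrightarrow> W y \<in> carrier_mat (2 ^ qB) dB"
      "\<And>y. y \<in> Y \<Longrightarrow> mat_adjoint (W y) * W y = 1\<^sub>m dB"
    and \<Phi>: "\<Phi> \<in> carrier_mat (dA * dB) 1" "mat_adjoint \<Phi> * \<Phi> = 1\<^sub>m 1"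
    and U: "U \<in> carrier_mat N N" "mat_adjoint U * U = 1\<^sub>m N"
    and out: "\<And>x y. x \<in> X \<Longrightarrow> y \<in> Y \<Longrightarrow> \<exists>k<N. \<exists>c. cnj c * c = 1 \<and> g k = f x y \<and>
      (\<forall>p<N. (kron (V x) (W y) * \<Phi>) $$ (p, 0) = c * U $$ (p, k))"
  shows "smp_entangled_exact qA qB X Y f"
proof -
  define G :: "bit \<Rightarrow> complex mat" where
    "G b = mat N N (\<lambda>(i, j). if i = j \<and> g i = b then 1 else 0)" for b
  \<comment> \<open>\<open>G b\<close> is the projector, in the measurement basis, onto the outcomes
    that \<open>g\<close> sends to \<open>b\<close>. The product with its own adjoint makes
    positivity immediate; idempotence of \<open>G b\<close> then gives the usual form
    \<open>E_eq\<close>.\<close>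
  define E where "E b = (U * G b) * mat_adjoint (U * G b)" for b
  define \<rho> where "\<rho> = \<Phi> * mat_adjoint \<Phi>"
  have Gc: "G b \<in> carrier_mat N N" for b by (simp add: G_def)
  have Gadj: "mat_adjoint (G b) = G b" for b
    by (rule eq_matI) (auto simp: G_def)
  have GG: "G b * G b = G b" for b
  proof (rule eq_matI)
    fix i j assume "i < dim_row (G b)" "j < dim_col (G b)"
    then have ij: "i < N" "j < N" by (auto simp: G_def)
    have "(G b * G b) $$ (i, j) = (\<Sum>l<N. G b $$ (i, l) * G b $$ (l, j))"
      using ij Gc[of b] by (simp add: scalar_prod_def atLeast0LessThan)
    also have "\<dots> = (\<Sum>l<N. if l = i then G b $$ (i, j) else 0)"
      using ij by (intro sum.cong) (auto simp: G_def)
    finally show "(G b * G b) $$ (i, j) = G b $$ (i, j)" using ij by simp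
  qed (auto simp: G_def)
  have E_eq: "E b = U * G b * mat_adjoint U" for b
  proof -
    have "E b = (U * G b) * (G b * mat_adjoint U)"
      using U Gc by (simp add: E_def mat_adjoint_mult[of _ N N _ N] Gadj)
    also have "\<dots> = U * (G b * G b) * mat_adjoint U"
      using U(1) Gc[of b] by (simp add: assoc_mult_mat[of _ N N _ N _ N])
    finally show ?thesis by (simp add: GG)
  qed
  have Ec: "E b \<in> carrier_mat N N" for b
    using U(1) Gc[of b] by (simp add: E_eq mult_carrier_mat[of _ N N _ N])
  \<comment> \<open>A left inverse of a square matrix is also a right inverse. This completeness of
    the columns makes the two effects sum to the identity.\<close>
  have UU: "U * mat_adjoint U = 1\<^sub>m N"
    using mat_mult_left_right_inverse[OF _ U(1) U(2)] U(1) by simp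
  have "G 0 + G 1 = 1\<^sub>m N"
  proof (rule eq_matI)
    fix i j assume "i < dim_row (1\<^sub>m N :: complex mat)" "j < dim_col (1\<^sub>m N :: complex mat)"
    then show "(G 0 + G 1) $$ (i, j) = 1\<^sub>m N $$ (i, j)"
      by (cases "g i") (auto simp: G_def)
  qed (auto simp: G_def)
  moreover have "E 0 + E 1 = U * (G 0 + G 1) * mat_adjoint U"
    using U(1) Gc
    by (simp add: E_eq mult_add_distrib_mat[of _ N N _ N] add_mult_distrib_mat[of _ N N _ _ N])
  ultimately have "E 0 + E 1 = 1\<^sub>m N"
    using UU U(1) by simp
  then have povm: "binary_povm N E"
    using positive_semidefinite_mult_adjoint[of "U * G _" N N] U Gc
    by (auto simp: binary_povm_def E_def)
  have dens: "density_operator (dA * dB) \<rho>"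
    using positive_semidefinite_mult_adjoint[OF \<Phi>(1)] mat_trace_comm[OF \<Phi>(1), of "mat_adjoint \<Phi>"] \<Phi>
    by (simp add: density_operator_def \<rho>_def mat_trace_def)
  have prot: "smp_protocol dA dB qA qB X Y \<rho> (\<lambda>x. [V x]) (\<lambda>y. [W y]) E"
    using V W dens povm
    by (simp add: smp_protocol_def quantum_operation_def msum_def N_def right_add_zero_mat[of _ dA dA]
       right_add_zero_mat[of _ dB dB])
  have "smp_output_prob qA qB \<rho> (\<lambda>x. [V x]) (\<lambda>y. [W y]) E x y (f x y) = 1"
    if x: "x \<in> X" and y: "y \<in> Y" for x y
  proof -
    obtain k c where k: "k < N" and c: "cnj c * c = 1" and g: "g k = f x y"
      and entry: "\<forall>p<N. (kron (V x) (W y) * \<Phi>) $$ (p, 0) = c * U $$ (p, k)"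
      using out[OF x y] by blast
    define T where "T = kron (V x) (W y)"
    define \<psi> where "\<psi> = T * \<Phi>"
    \<comment> \<open>The coordinates of \<open>\<psi>\<close> in the basis of columns of
      \<open>U\<close>; \<open>G (f x y)\<close> fixes them because
      \<open>g k = f x y\<close>.\<close>
    define u where "u = mat N 1 (\<lambda>(i, j). if i = k then c else 0)"
    have Tc: "T \<in> carrier_mat N (dA * dB)"
      unfolding T_def N_def by (rule kron_carrier[OF V(1)[OF x] W(1)[OF y]])
    have \<psi>c: "\<psi> \<in> carrier_mat N 1" using Tc \<Phi>(1) by (simp add: \<psi>_def)
    have uc: "u \<in> carrier_mat N 1" by (simp add: u_def)
    have \<psi>_eq: "\<psi> = U * u"
    proof (rule eq_matI)
      fix i j assume "i < dim_row (U * u)" "j < dim_col (U * u)"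
      then have ij: "i < N" "j = 0" using U uc by auto
      have "(U * u) $$ (i, 0) = (\<Sum>l<N. U $$ (i, l) * u $$ (l, 0))"
        using U(1) ij uc by (simp add: scalar_prod_def atLeast0LessThan)
      also have "\<dots> = (\<Sum>l<N. if l = k then U $$ (i, l) * c else 0)"
        by (intro sum.cong) (auto simp: u_def)
      also have "\<dots> = \<psi> $$ (i, 0)"
        using entry ij k by (simp add: \<psi>_def T_def mult.commute)
      finally show "\<psi> $$ (i, j) = (U * u) $$ (i, j)" using ij by simp
    qed (use \<psi>c U uc in auto)
    have Gu: "G (f x y) * u = u"
    proof (rule eq_matI)
      fix i j assume "i < dim_row u" "j < dim_col u"
      then have ij: "i < N" "j = 0" by (auto simp: u_def)
      have "(G (f x y) * u) $$ (i, 0) = (\<Sum>l<N. G (f x y) $$ (i, l) * u $$ (l, 0))"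
        using ij uc Gc[of "f x y"] by (simp add: scalar_prod_def atLeast0LessThan)
      also have "\<dots> = (\<Sum>l<N. if l = i then u $$ (i, 0) else 0)"
        using ij g by (intro sum.cong) (auto simp: G_def u_def)
      finally show "(G (f x y) * u) $$ (i, j) = u $$ (i, j)" using ij by simp
    qed (auto simp: G_def u_def)
    have "E (f x y) * \<psi> = U * (G (f x y) * ((mat_adjoint U * U) * u))"
      using U(1) uc Gc[of "f x y"]
      by (simp add: E_eq \<psi>_eq assoc_mult_mat[of _ N N _ N _ N] assoc_mult_mat[of _ N N _ N _ 1])
    also have "\<dots> = \<psi>"
      using uc by (simp add: U(2) Gu \<psi>_eq)
    finally have E\<psi>: "E (f x y) * \<psi> = \<psi>" .
    \<comment> \<open>Since \<open>U\<close> preserves norms, the squared norm of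
      \<open>\<psi>\<close> is that of \<open>u\<close>, namely \<open>cnj c * c\<close>.\<close>
    have "mat_adjoint \<psi> * \<psi> = mat_adjoint u * mat_adjoint U * (U * u)"
      using U(1) uc by (simp add: \<psi>_eq mat_adjoint_mult[of _ N N _ 1])
    also have "\<dots> = mat_adjoint u * (mat_adjoint U * (U * u))"
      by (rule assoc_mult_mat[of _ 1 N _ N _ 1]) (use U(1) uc in simp_all)
    also have "mat_adjoint U * (U * u) = mat_adjoint U * U * u"
      by (rule assoc_mult_mat[of _ N N _ N _ 1, symmetric]) (use U(1) uc in simp_all)
    also have "\<dots> = u"
      using uc by (simp add: U(2))
    finally have "mat_trace (mat_adjoint \<psi> * \<psi>) = mat_trace (mat_adjoint u * u)" by simp
    also have "\<dots> = (\<Sum>i<N. cnj (u $$ (i, 0)) * u $$ (i, 0))"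
      using uc by (simp add: mat_trace_def scalar_prod_def atLeast0LessThan)
    also have "\<dots> = (\<Sum>i<N. if i = k then cnj c * c else 0)"
      by (intro sum.cong) (auto simp: u_def)
    finally have norm: "mat_trace (mat_adjoint \<psi> * \<psi>) = 1"
      using k c by simp
    have \<rho>c: "\<rho> \<in> carrier_mat (dA * dB) (dA * dB)"
      using \<Phi>(1) by (simp add: \<rho>_def mult_carrier_mat[of _ _ 1])
    \<comment> \<open>With one Kraus operator per party the joint message is the pure state of
      \<open>\<psi>\<close>; as \<open>E (f x y)\<close> fixes \<open>\<psi>\<close>, cyclicity of
      the trace turns the probability into the norm above.\<close>
    have "T * \<rho> * mat_adjoint T \<in> carrier_mat N N"
      by (intro mult_carrier_mat[OF mult_carrier_mat[OF Tc \<rho>c]] mat_adjoint_carrier[OF Tc])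
    then have "apply_local (2 ^ qA) (2 ^ qB) [V x] [W y] \<rho> = T * \<rho> * mat_adjoint T"
      by (simp add: apply_local_def msum_def flip: T_def N_def)
    also have "T * \<rho> = \<psi> * mat_adjoint \<Phi>"
      unfolding \<rho>_def \<psi>_def
      by (rule assoc_mult_mat[OF Tc \<Phi>(1) mat_adjoint_carrier[OF \<Phi>(1)], symmetric])
    also have "\<psi> * mat_adjoint \<Phi> * mat_adjoint T = \<psi> * (mat_adjoint \<Phi> * mat_adjoint T)"
      by (rule assoc_mult_mat[OF \<psi>c mat_adjoint_carrier[OF \<Phi>(1)] mat_adjoint_carrier[OF Tc]])
    also have "mat_adjoint \<Phi> * mat_adjoint T = mat_adjoint \<psi>"
      unfolding \<psi>_def by (rule mat_adjoint_mult[OF Tc \<Phi>(1), symmetric])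
    finally have "smp_output_prob qA qB \<rho> (\<lambda>x. [V x]) (\<lambda>y. [W y]) E x y (f x y)
        = mat_trace ((E (f x y) * \<psi>) * mat_adjoint \<psi>)"
      using \<psi>c Ec[of "f x y"] by (simp add: smp_output_prob_def assoc_mult_mat[of _ N N _ 1 _ N])
    then show ?thesis
      using mat_trace_comm[OF \<psi>c, of "mat_adjoint \<psi>"] \<psi>c norm by (simp add: E\<psi>)
  qed
  with prot show ?thesis
    unfolding smp_entangled_exact_def by blast
qed

section \<open>Characters of the group of subsets under symmetric difference\<close>

text \<open>The weight identity by which the referee decodes; its reduction modulo 2 also makes
  \<open>chi\<close> multiplicative.\<close>

lemma card_sym_diff_Int:
  assumes "finite A" "finite B"
  shows "card A + card B = card (sym_diff A B) + 2 * card (A \<inter> B)"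
proof -
  have "card (sym_diff A B) = card (A - B) + card (B - A)"
    using assms by (intro card_Un_disjoint) auto
  moreover have "card A = card (A - B) + card (A \<inter> B)" "card B = card (B - A) + card (A \<inter> B)"
    using assms card_Diff_subset_Int[of A B] card_Diff_subset_Int[of B A]
      card_mono[of A "A \<inter> B"] card_mono[of B "A \<inter> B"] by (auto simp: Int_commute)
  ultimately show ?thesis by simp
qed

text \<open>The character (-1)^(t.a) of bit strings, with strings encoded as subsets so that bitwise
  addition is \<open>sym_diff\<close>.\<close>

definition chi :: "nat set \<Rightarrow> nat set \<Rightarrow> complex" where
  "chi T A = (-1) ^ card (T \<inter> A)"

lemma cnj_chi [simp]: "cnj (chi T A) = chi T A"
  by (simp add: chi_def)

lemma chi_square [simp]: "chi T A * chi T A = 1"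
  by (simp add: chi_def flip: power_add)

lemma chi_commute: "chi T A = chi A T"
  by (simp add: chi_def Int_commute)

lemma chi_sym_diff:
  assumes "finite T"
  shows "chi T (sym_diff A B) = chi T A * chi T B"
proof -
  have "T \<inter> sym_diff A B = sym_diff (T \<inter> A) (T \<inter> B)" by blast
  then have "card (T \<inter> A) + card (T \<inter> B)
      = card (T \<inter> sym_diff A B) + 2 * card (T \<inter> A \<inter> (T \<inter> B))"
    using card_sym_diff_Int[of "T \<inter> A" "T \<inter> B"] assms by simp
  then have "(-1 :: complex) ^ (card (T \<inter> A) + card (T \<inter> B)) = (-1) ^ card (T \<inter> sym_diff A B)"
    by (simp add: power_add power_mult)
  then show ?thesis by (simp add: chi_def power_add)
qed

lemma chi_sym_diff_left:
  assumes "finite A"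
  shows "chi (sym_diff S T) A = chi S A * chi T A"
  using chi_sym_diff[OF assms, of S T] by (simp only: chi_commute[of A])

text \<open>Orthogonality of characters: for \<open>t\<close> in \<open>T\<close>, toggling
  \<open>t\<close> permutes the subsets and flips every sign, so the sum equals its own
  negative.\<close>

lemma sum_chi:
  assumes T: "T \<subseteq> {..<m}"
  shows "(\<Sum>A\<in>Pow {..<m}. chi T A) = (if T = {} then 2 ^ m else 0)"
proof (cases "T = {}")
  case True
  then show ?thesis by (simp add: chi_def card_Pow)
next
  case False
  then obtain t where t: "t \<in> T" by blast
  have fin: "finite T" using T finite_subset by blast
  have "chi T {t} = -1" using t by (simp add: chi_def)
  then have neg: "chi T (sym_diff A {t}) = - chi T A" for A
    by (simp only: chi_sym_diff[OF fin] mult_minus1_right)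
  have "bij_betw (\<lambda>A. sym_diff A {t}) (Pow {..<m}) (Pow {..<m})"
    using T t by (intro bij_betw_byWitness[where f' = "\<lambda>A. sym_diff A {t}"]) auto
  then have "(\<Sum>A\<in>Pow {..<m}. chi T A) = (\<Sum>A\<in>Pow {..<m}. chi T (sym_diff A {t}))"
    by (rule sum.reindex_bij_betw[symmetric])
  then have "(\<Sum>A\<in>Pow {..<m}. chi T A) = - (\<Sum>A\<in>Pow {..<m}. chi T A)"
    by (simp only: neg sum_negf)
  then show ?thesis using False by simp
qed

section \<open>Pauli encodings and the Bell measurement\<close>

definition lo :: "nat \<Rightarrow> nat set \<Rightarrow> nat set" where
  "lo m S = S \<inter> {..<m}"

text \<open>Shifted down by \<open>m\<close>, so that both halves of an input index the same
  \<open>m\<close> qubits.\<close>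

definition hi :: "nat \<Rightarrow> nat set \<Rightarrow> nat set" where
  "hi m S = {i. i + m \<in> S}"

lemma card_lo_hi:
  assumes "finite S"
  shows "card (lo m S) + card (hi m S) = card S"
proof -
  have "bij_betw (\<lambda>i. i + m) (hi m S) (S - {..<m})"
    by (rule bij_betw_byWitness[where f' = "\<lambda>i. i - m"]) (auto simp: hi_def)
  then have "card (hi m S) = card (S - {..<m})"
    by (rule bij_betw_same_card)
  then show ?thesis
    using assms card_Un_disjoint[of "lo m S" "S - {..<m}"]
    by (simp add: lo_def Int_Diff_Un Int_Diff_disjoint)
qed

lemma sym_diff_lo: "sym_diff (lo m S) (lo m T) = lo m (sym_diff S T)"
  by (auto simp: lo_def)

lemma sym_diff_hi: "sym_diff (hi m S) (hi m T) = hi m (sym_diff S T)"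
  by (auto simp: hi_def)

lemma lo_subset: "lo m S \<subseteq> {..<m}"
  by (auto simp: lo_def)

lemma hi_subset: "S \<subseteq> {..<2 * m} \<Longrightarrow> hi m S \<subseteq> {..<m}"
  by (fastforce simp: hi_def)

text \<open>An input \<open>S \<subseteq> {..<2 * m}\<close> selects the Pauli operator that shifts by \<open>lo m S\<close> and whose phases are
  the character of \<open>hi m S\<close>. A message label \<open>(a, u)\<close> consists of a basis state \<open>a \<subseteq> {..<m}\<close> of the
  \<open>m\<close> encoded qubits and a residue \<open>u < 4\<close>.\<close>

definition pauli :: "nat \<Rightarrow> nat set \<Rightarrow> nat set \<times> nat \<Rightarrow> nat set \<Rightarrow> complex" where
  "pauli m S p z = (if p = (sym_diff z (lo m S), card S mod 4) then chi (hi m S) z else 0)"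

text \<open>The entry at row \<open>((a, u), (b, v))\<close> of the column for the outcome: shift \<open>s\<close>, phase \<open>t\<close>,
  residues \<open>w\<close> and \<open>w'\<close>.\<close>

definition bell ::
  "nat \<Rightarrow> (nat set \<times> nat) \<times> (nat set \<times> nat) \<Rightarrow> (nat set \<times> nat) \<times> (nat set \<times> nat) \<Rightarrow> complex" where
  "bell m = (\<lambda>((a, u), (b, v)) ((s, w), (t, w')).
     if u = w \<and> v = w' \<and> b = sym_diff a s then complex_of_real (1 / sqrt (2 ^ m)) * chi t a else 0)"

text \<open>Normalises superpositions of \<open>2 ^ m\<close> equal amplitudes: the columns of
  \<open>bell\<close> and, later, the shared state.\<close>

lemma bell_normalisation:
  "complex_of_real (1 / sqrt (2 ^ m)) * complex_of_real (1 / sqrt (2 ^ m)) * 2 ^ m = 1"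
proof -
  have "complex_of_real (1 / sqrt (2 ^ m)) * complex_of_real (1 / sqrt (2 ^ m)) * 2 ^ m
      = complex_of_real (1 / sqrt (2 ^ m) * (1 / sqrt (2 ^ m)) * 2 ^ m)"
    by (simp only: of_real_mult of_real_power of_real_numeral)
  also have "1 / sqrt (2 ^ m) * (1 / sqrt (2 ^ m)) * 2 ^ m = (1::real)" by simp
  finally show ?thesis by (simp only: of_real_1)
qed

abbreviation labels :: "nat \<Rightarrow> (nat set \<times> nat) set" where
  "labels m \<equiv> Pow {..<m} \<times> {..<4}"

text \<open>Each column has a single nonzero entry, which is a sign, and the shift by
  \<open>lo m S\<close> is injective, so distinct columns have disjoint supports. This makes the
  encoding an isometry.\<close>

lemma pauli_orthonormal:
  assumes S: "S \<subseteq> {..<2 * m}" and z: "z \<in> Pow {..<m}" "z' \<in> Pow {..<m}"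
  shows "(\<Sum>p\<in>labels m. cnj (pauli m S p z) * pauli m S p z') = (if z = z' then 1 else 0)"
proof (cases "z = z'")
  case True
  have "(\<Sum>p\<in>labels m. cnj (pauli m S p z) * pauli m S p z)
      = (\<Sum>p\<in>labels m. if p = (sym_diff z (lo m S), card S mod 4) then 1 else 0)"
    by (intro sum.cong) (auto simp: pauli_def)
  also have "\<dots> = 1"
    using z lo_subset[of m S] by (subst sum.delta) auto
  finally show ?thesis using True by simp
next
  case False
  then have "sym_diff z (lo m S) \<noteq> sym_diff z' (lo m S)" by blast
  then show ?thesis
    using False by (intro trans[OF sum.neutral]) (auto simp: pauli_def)
qed

text \<open>Columns that differ in the shift or in a residue have disjoint supports. Otherwise only
  the phase labels can differ, and the product reduces to the character sum for
  \<open>sym_diff t t'\<close>.\<close>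

lemma bell_orthonormal:
  assumes k: "k \<in> labels m \<times> labels m" "k' \<in> labels m \<times> labels m"
  shows "(\<Sum>p\<in>labels m \<times> labels m. cnj (bell m p k) * bell m p k') = (if k = k' then 1 else 0)"
proof -
  obtain s w t v where K: "k = ((s, w), (t, v))" by (metis surj_pair)
  obtain s' w' t' v' where K': "k' = ((s', w'), (t', v'))" by (metis surj_pair)
  have st: "s \<subseteq> {..<m}" "t \<subseteq> {..<m}" "t' \<subseteq> {..<m}" "w < 4" "v < 4" using k K K' by auto
  show ?thesis
  proof (cases "s = s' \<and> w = w' \<and> v = v'")
    case True
    define c where "c = complex_of_real (1 / sqrt (2 ^ m))"
    have tt: "sym_diff t t' \<subseteq> {..<m}" using st by blast
    have cnj_c: "cnj c = c" by (simp add: c_def)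
    have K'': "k' = ((s, w), (t', v))" using True K' by simp
    have c: "c * c * 2 ^ m = 1"
      unfolding c_def by (rule bell_normalisation)
    \<comment> \<open>Once Alice's label \<open>(a, u)\<close> is fixed, shift and residue leave
      only one possible label \<open>q\<close> for Bob.\<close>
    have inner: "(\<Sum>q\<in>labels m. cnj (bell m ((a, u), q) k) * bell m ((a, u), q) k')
        = (if u = w then c * c * chi (sym_diff t t') a else 0)" if a: "a \<subseteq> {..<m}" for a u
    proof -
      have fin: "finite a" using a finite_subset by blast
      have bell_eq: "bell m ((a, u), q) ((s, w), (r, v))
          = (if q = (sym_diff a s, v) then (if u = w then c * chi r a else 0) else 0)" for q r
        by (cases q) (simp add: bell_def c_def)
      have "(\<Sum>q\<in>labels m. cnj (bell m ((a, u), q) k) * bell m ((a, u), q) k')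
         = (\<Sum>q\<in>labels m. if q = (sym_diff a s, v) then
              (if u = w then c * c * chi (sym_diff t t') a else 0) else 0)"
        unfolding K K''
        by (intro sum.cong refl) (simp add: bell_eq chi_sym_diff_left[OF fin] cnj_c mult_ac)
      also have "\<dots> = (if u = w then c * c * chi (sym_diff t t') a else 0)"
        using a st by (subst sum.delta) auto
      finally show ?thesis .
    qed
    have "(\<Sum>p\<in>labels m \<times> labels m. cnj (bell m p k) * bell m p k')
        = (\<Sum>a\<in>Pow {..<m}. \<Sum>u<4. \<Sum>q\<in>labels m. cnj (bell m ((a, u), q) k) * bell m ((a, u), q) k')"
      by (simp add: sum.cartesian_product' case_prod_beta)
    also have "\<dots> = (\<Sum>a\<in>Pow {..<m}. c * c * chi (sym_diff t t') a)"
      using st by (intro sum.cong) (auto simp: inner)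
    also have "\<dots> = (if sym_diff t t' = {} then 1 else 0)"
      unfolding sum_distrib_left[symmetric] sum_chi[OF tt] using c by auto
    finally show ?thesis using True K K' by auto
  next
    case False
    then have "cnj (bell m p k) * bell m p k' = 0" for p
      by (auto simp: bell_def K K' split: prod.splits) 
    then show ?thesis using False K K' by auto
  qed
qed

text \<open>The left side is the amplitude after both encodings act on the EPR pairs. Alice's label
  forces \<open>z\<close>, and multiplicativity of \<open>chi\<close> merges the two phases.
  Substituting for \<open>z\<close> leaves the phase of the Bell column and a sign independent of
  \<open>p\<close> and \<open>q\<close>, hence global.\<close>

lemma pauli_pair_eq_bell:
  assumes S: "S \<subseteq> {..<2 * m}" and T: "T \<subseteq> {..<2 * m}"
    and p: "p \<in> labels m" and q: "q \<in> labels m"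
  shows "(\<Sum>z\<in>Pow {..<m}. pauli m S p z * pauli m T q z) * complex_of_real (1 / sqrt (2 ^ m))
     = chi (hi m (sym_diff S T)) (lo m S)
       * bell m (p, q) ((lo m (sym_diff S T), card S mod 4), (hi m (sym_diff S T), card T mod 4))"
proof -
  obtain a u where pa: "p = (a, u)" by fastforce
  obtain b v where qb: "q = (b, v)" by fastforce
  have a: "a \<subseteq> {..<m}" using p pa by simp
  \<comment> \<open>The only basis state that Alice's shift takes to \<open>a\<close>.\<close>
  define z0 where "z0 = sym_diff a (lo m S)"
  have z0: "z0 \<subseteq> {..<m}" using a lo_subset[of m S] by (auto simp: z0_def)
  have fin: "finite z0" using z0 finite_subset by blast
  have finh: "finite (hi m (sym_diff S T))"
    using hi_subset[of "sym_diff S T" m] S T finite_subset[of _ "{..<m}"] by auto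
  have eq1: "a = sym_diff z (lo m S) \<longleftrightarrow> z = z0" for z unfolding z0_def by blast
  have eq2: "b = sym_diff z0 (lo m T) \<longleftrightarrow> b = sym_diff a (lo m (sym_diff S T))"
    unfolding z0_def sym_diff_lo[symmetric] by blast
  have "(\<Sum>z\<in>Pow {..<m}. pauli m S p z * pauli m T q z)
      = (\<Sum>z\<in>Pow {..<m}. if z = z0 then
          (if u = card S mod 4 \<and> v = card T mod 4 \<and> b = sym_diff z0 (lo m T)
           then chi (hi m S) z0 * chi (hi m T) z0 else 0) else 0)"
    by (intro sum.cong) (auto simp: pauli_def pa qb eq1)
  also have "\<dots> = (if u = card S mod 4 \<and> v = card T mod 4 \<and> b = sym_diff z0 (lo m T)
           then chi (hi m S) z0 * chi (hi m T) z0 else 0)"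
    using z0 by (subst sum.delta) auto
  also have "chi (hi m S) z0 * chi (hi m T) z0 = chi (hi m (sym_diff S T)) z0"
    using chi_sym_diff_left[OF fin] sym_diff_hi by metis
  also have "\<dots> = chi (hi m (sym_diff S T)) (lo m S) * chi (hi m (sym_diff S T)) a"
    using chi_sym_diff[OF finh] by (simp add: z0_def mult.commute)
  finally show ?thesis
    by (auto simp: bell_def pa qb eq2)
qed

section \<open>The inner product as the parity of an intersection, and its decoding\<close>

definition support :: "bit vec \<Rightarrow> nat set" where
  "support x = {i. i < dim_vec x \<and> x $ i = 1}"

lemma of_nat_bit: "(of_nat k :: bit) = of_bool (odd k)"
  by (induction k) auto

lemma bit_mult_eq: "(a :: bit) * b = (if a = 1 \<and> b = 1 then 1 else 0)"
  by auto

lemma inner_product_fun_support: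
  assumes "x \<in> carrier_vec n" "y \<in> carrier_vec n"
  shows "inner_product_fun x y = of_bool (odd (card (support x \<inter> support y)))"
proof -
  have "inner_product_fun x y = (\<Sum>i<n. x $ i * y $ i)"
    using assms by (simp add: inner_product_fun_def scalar_prod_def atLeast0LessThan)
  also have "\<dots> = (\<Sum>i<n. if i \<in> support x \<inter> support y then 1 else 0)"
    using assms by (intro sum.cong refl) (simp add: support_def bit_mult_eq)
  also have "\<dots> = of_nat (card ({..<n} \<inter> (support x \<inter> support y)))"
    by (simp only: sum.inter_restrict[OF finite_lessThan, symmetric] of_nat_sum card_eq_sum of_nat_1)
  also have "{..<n} \<inter> (support x \<inter> support y) = support x \<inter> support y"
    using assms by (auto simp: support_def)
  finally show ?thesis by (simp only: of_nat_bit)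
qed

text \<open>The two residues are \<open>|S|\<close> and \<open>|T|\<close> modulo 4, and
  \<open>|S| + |T| = |S \<oplus> T| + 2 |S \<inter> T|\<close>.\<close>

definition referee :: "(nat set \<times> nat) \<times> (nat set \<times> nat) \<Rightarrow> bit" where
  "referee = (\<lambda>((s, w), (t, w')). of_bool ((w + w') mod 4 \<noteq> (card s + card t) mod 4))"

text \<open>The two halves of the Bell outcome recombine to the weight of
  \<open>sym_diff S T\<close>. The residues exceed it by twice the size of the intersection, which
  vanishes modulo 4 exactly when that size is even.\<close>

lemma referee_eq:
  assumes "finite S" "finite T"
  shows "referee ((lo m (sym_diff S T), card S mod 4), (hi m (sym_diff S T), card T mod 4))
    = of_bool (odd (card (S \<inter> T)))"
proof -
  have 1: "card (lo m (sym_diff S T)) + card (hi m (sym_diff S T)) = card (sym_diff S T)"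
    using assms by (intro card_lo_hi) auto
  have 2: "(card S mod 4 + card T mod 4) mod 4
      = (card (sym_diff S T) + 2 * card (S \<inter> T)) mod 4"
    unfolding mod_add_eq card_sym_diff_Int[OF assms] ..
  have 3: "(d + 2 * i) mod 4 \<noteq> d mod 4 \<longleftrightarrow> odd i" for d i :: nat
    by presburger
  show ?thesis
    unfolding referee_def prod.case 1 2 3 ..
qed

section \<open>The protocol as concrete matrices\<close>

lemma smp_entangled_exact_inner_product:
  assumes nm: "n \<le> 2 * m"
  shows "smp_entangled_exact (m + 2) (m + 2) (carrier_vec n) (carrier_vec n) inner_product_fun"
proof -
  \<comment> \<open>\<open>D\<close> is the dimension of half of the EPR pairs; a message has
    dimension \<open>N = 4 * D\<close>, the factor 4 holding the residue. The numberings
    \<open>e\<close> and \<open>h\<close> of basis states may be any bijections.\<close>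
  define N D :: nat where "N = 2 ^ (m + 2)" and "D = 2 ^ m"
  have "card (Pow {..<m}) = D" by (simp add: D_def card_Pow)
  then obtain e where e: "bij_betw e {..<D} (Pow {..<m})"
    using ex_bij_betw_nat_finite[of "Pow {..<m}"] by (auto simp: atLeast0LessThan)
  have "card (labels m) = N" by (simp add: N_def card_Pow power_add)
  then obtain h where h: "bij_betw h {..<N} (labels m)"
    using ex_bij_betw_nat_finite[of "labels m"] by (auto simp: atLeast0LessThan)
  \<comment> \<open>Splits \<open>p\<close> as \<open>kron\<close> does, so that row
    \<open>p\<close> of \<open>kron (V x) (V y)\<close> carries the label pair
    \<open>H p\<close>.\<close>
  define H where "H p = (h (p div N), h (p mod N))" for p
  have H: "bij_betw H {..<N * N} (labels m \<times> labels m)"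
    using bij_betw_trans[OF bij_betw_div_mod[of N N] bij_betw_map_prod[OF h h]]
    by (simp add: H_def[abs_def] comp_def)
  have eD: "e i \<in> Pow {..<m}" if "i < D" for i
    using e that by (auto simp: bij_betw_def)
  have hN: "h i \<in> labels m" if "i < N" for i
    using h that unfolding bij_betw_def by blast
  have HN: "H p \<in> labels m \<times> labels m" if "p < N * N" for p
    using H that unfolding bij_betw_def by blast
  have e_inj: "e i = e j \<longleftrightarrow> i = j" if "i < D" "j < D" for i j
    using e that by (auto simp: bij_betw_def inj_on_def)
  have H_inj: "H i = H j \<longleftrightarrow> i = j" if "i < N * N" "j < N * N" for i j
    using H that by (auto simp: bij_betw_def inj_on_def)
  define c where "c = complex_of_real (1 / sqrt (2 ^ m))"
  have c: "cnj c * c * D = 1"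
    using bell_normalisation[of m] by (simp add: c_def D_def)
  define V where "V x = mat N D (\<lambda>(r, j). pauli m (support x) (h r) (e j))" for x
  \<comment> \<open>The \<open>m\<close> EPR pairs: equal amplitudes on pairs of equal indices. Both
    parties encode with the same \<open>V\<close>.\<close>
  define \<Phi> where "\<Phi> = mat (D * D) 1 (\<lambda>(i, _). if i div D = i mod D then c else 0)"
  define U where "U = mat (N * N) (N * N) (\<lambda>(p, k). bell m (H p) (H k))"
  have supp: "support x \<subseteq> {..<2 * m}" if "x \<in> carrier_vec n" for x
    using that nm by (auto simp: support_def)
  have Vc: "V x \<in> carrier_mat N D" for x by (simp add: V_def)
  have isom: "mat_adjoint (V x) * V x = 1\<^sub>m D" if x: "x \<in> carrier_vec n" for x
  proof (rule eq_matI)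
    fix i j assume "i < dim_row (1\<^sub>m D :: complex mat)" "j < dim_col (1\<^sub>m D :: complex mat)"
    then have ij: "i < D" "j < D" by auto
    have "(mat_adjoint (V x) * V x) $$ (i, j)
        = (\<Sum>r<N. cnj (pauli m (support x) (h r) (e i)) * pauli m (support x) (h r) (e j))"
      using ij by (simp add: V_def scalar_prod_def atLeast0LessThan)
    also have "\<dots> = (\<Sum>p\<in>labels m. cnj (pauli m (support x) p (e i)) * pauli m (support x) p (e j))"
      by (rule sum.reindex_bij_betw[OF h])
    also have "\<dots> = (if i = j then 1 else 0)"
      using pauli_orthonormal[OF supp[OF x] eD eD] ij e_inj by simp
    finally show "(mat_adjoint (V x) * V x) $$ (i, j) = 1\<^sub>m D $$ (i, j)"
      using ij by simp
  qed (auto simp: V_def)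
  have Uc: "U \<in> carrier_mat (N * N) (N * N)" by (simp add: U_def)
  have unit: "mat_adjoint U * U = 1\<^sub>m (N * N)"
  proof (rule eq_matI)
    fix i j assume "i < dim_row (1\<^sub>m (N * N) :: complex mat)" "j < dim_col (1\<^sub>m (N * N) :: complex mat)"
    then have ij: "i < N * N" "j < N * N" by auto
    have "(mat_adjoint U * U) $$ (i, j) = (\<Sum>p<N * N. cnj (bell m (H p) (H i)) * bell m (H p) (H j))"
      using ij by (simp add: U_def scalar_prod_def atLeast0LessThan)
    also have "\<dots> = (\<Sum>p\<in>labels m \<times> labels m. cnj (bell m p (H i)) * bell m p (H j))"
      by (rule sum.reindex_bij_betw[OF H])
    also have "\<dots> = (if i = j then 1 else 0)"
      using bell_orthonormal[OF HN HN] ij H_inj by simp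
    finally show "(mat_adjoint U * U) $$ (i, j) = 1\<^sub>m (N * N) $$ (i, j)"
      using ij by simp
  qed (auto simp: U_def)
  have \<Phi>c: "\<Phi> \<in> carrier_mat (D * D) 1" by (simp add: \<Phi>_def)
  have norm: "mat_adjoint \<Phi> * \<Phi> = 1\<^sub>m 1"
  proof (rule eq_matI)
    fix i j assume "i < dim_row (1\<^sub>m 1 :: complex mat)" "j < dim_col (1\<^sub>m 1 :: complex mat)"
    then have ij: "i = 0" "j = 0" by auto
    have "(mat_adjoint \<Phi> * \<Phi>) $$ (0, 0) = (\<Sum>i<D * D. cnj (\<Phi> $$ (i, 0)) * \<Phi> $$ (i, 0))"
      using \<Phi>c by (simp add: scalar_prod_def atLeast0LessThan)
    also have "\<dots> = (\<Sum>i<D * D. if i div D = i mod D then cnj c * c else 0)"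
      by (intro sum.cong) (auto simp: \<Phi>_def)
    also have "\<dots> = (\<Sum>i<D. \<Sum>j<D. if i = j then cnj c * c else 0)"
      by (rule sum_div_mod)
    also have "\<dots> = 1" using c by (simp add: mult_ac)
    finally show "(mat_adjoint \<Phi> * \<Phi>) $$ (i, j) = 1\<^sub>m 1 $$ (i, j)" using ij by simp
  qed (auto simp: \<Phi>_def)
  have out: "\<exists>k<N * N. \<exists>d. cnj d * d = 1 \<and> referee (H k) = inner_product_fun x y \<and>
      (\<forall>p<N * N. (kron (V x) (V y) * \<Phi>) $$ (p, 0) = d * U $$ (p, k))"
    if x: "x \<in> carrier_vec n" and y: "y \<in> carrier_vec n" for x y
  proof -
    let ?S = "support x" and ?T = "support y"
    define l where "l = ((lo m (sym_diff ?S ?T), card ?S mod 4), (hi m (sym_diff ?S ?T), card ?T mod 4))"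
    define d where "d = chi (hi m (sym_diff ?S ?T)) (lo m ?S)"
    have "l \<in> labels m \<times> labels m"
      using lo_subset[of m "sym_diff ?S ?T"] hi_subset[of "sym_diff ?S ?T" m] supp[OF x] supp[OF y]
      by (auto simp: l_def)
    then obtain k where k: "k < N * N" "H k = l"
      using H unfolding bij_betw_def by (metis image_iff lessThan_iff)
    have "referee l = inner_product_fun x y"
      unfolding l_def inner_product_fun_support[OF x y]
      by (intro referee_eq) (auto simp: support_def)
    moreover have "(kron (V x) (V y) * \<Phi>) $$ (p, 0) = d * U $$ (p, k)" if p: "p < N * N" for p
    proof -
      let ?a = "h (p div N)" and ?b = "h (p mod N)"
      have pN: "p div N < N" "p mod N < N"
        using p div_less_factor mod_less_factor by blast+
      have "(kron (V x) (V y) * \<Phi>) $$ (p, 0)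
         = (\<Sum>i<D * D. kron (V x) (V y) $$ (p, i) * \<Phi> $$ (i, 0))"
        using p kron_carrier[OF Vc Vc, of x y] \<Phi>c by (simp add: scalar_prod_def atLeast0LessThan)
      also have "\<dots> = (\<Sum>i<D * D. pauli m ?S ?a (e (i div D)) * pauli m ?T ?b (e (i mod D))
              * (if i div D = i mod D then c else 0))"
        using p pN
        by (intro sum.cong refl) (simp add: kron_def V_def \<Phi>_def div_less_factor mod_less_factor)
      also have "\<dots> = (\<Sum>i<D. \<Sum>j<D. pauli m ?S ?a (e i) * pauli m ?T ?b (e j) * (if i = j then c else 0))"
        by (rule sum_div_mod)
      \<comment> \<open>The shared state is supported on the diagonal, leaving the single sum of
        \<open>pauli_pair_eq_bell\<close>.\<close>
      also have "\<dots> = (\<Sum>i<D. pauli m ?S ?a (e i) * pauli m ?T ?b (e i)) * c"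
        by (simp add: if_distrib sum_distrib_right cong: if_cong)
      also have "\<dots> = (\<Sum>z\<in>Pow {..<m}. pauli m ?S ?a z * pauli m ?T ?b z) * c"
        by (subst sum.reindex_bij_betw[OF e]) simp
      also have "\<dots> = d * bell m (?a, ?b) l"
        unfolding c_def d_def l_def
        by (rule pauli_pair_eq_bell[OF supp[OF x] supp[OF y] hN[OF pN(1)] hN[OF pN(2)]])
      also have "\<dots> = d * U $$ (p, k)"
        using p k by (simp add: U_def H_def)
      finally show ?thesis .
    qed
    ultimately show ?thesis using k by (auto simp: d_def intro!: exI[of _ k] exI[of _ d])
  qed
  show ?thesis
    by (rule smp_entangled_exact_isometries[where V = V and W = V and \<Phi> = \<Phi> and U = U
          and g = "\<lambda>k. referee (H k)" and dA = D and dB = D and qA = "m + 2" and qB = "m + 2",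
          folded N_def])
      (rule Vc Uc unit \<Phi>c norm | erule isom | erule (1) out)+
qed

theorem claim16:
  fixes n :: nat
  assumes "n \<ge> 1"
  shows "smp_entangled_exact (nat \<lceil>real n / 2\<rceil> + 2) (nat \<lceil>real n / 2\<rceil> + 2)
           (carrier_vec n) (carrier_vec n) inner_product_fun"
  \<comment> \<open>With \<open>m\<close> the rounded-up half of \<open>n\<close>, what remains is
    \<open>n \<le> 2 * m\<close>.\<close>
  by (rule smp_entangled_exact_inner_product) linarith

end
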